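(* Consider the following optimization problem over real variables $c_1^o,\dots,c_F^o$: $$\min_{\{c_i^o\}}\ \sum_{i=1}^F f_i\left(L-c_i^o-\sum_{n=0}^\infty p_n\sum_{\{d_i^1,\dots,d_i^n\}\in\mathcal E}p_{\{d_i^1,\dots,d_i^n\}}\,u\left\lfloor\frac{L}{u\mu}\,\mathbb P[\rho>\tau\mid u=1]\log(1+\tau)\right\rfloor\right)^+$$ $$\text{subject to}\quad 0\le c_i^o\le L\ \ \text{for all } i\in\{1,\dots,F\},\qquad \sum_{i=1}^F c_i^o\le M.$$ Define $$\nu=\sum_{n=0}^\infty p_n\sum_{\{d_i^1,\dots,d_i^n\}\in\mathcal E}p_{\{d_i^1,\dots,d_i^n\}}\,u\left\lfloor\frac{L}{u\mu}\,\mathbb P[\rho>\tau\mid u=1]\log(1+\tau)\right\rfloor .$$ The optimal solution $\{c_{i,\mathrm{OM}}^o\}$ of this problem is $$c_{i,\mathrm{OM}}^o=\begin{cases}L-\nu & \text{for } i<k,\\ M-(k-1)(L-\nu) & \text{for } i=k,\\ 0&\text{for } i>k,\end{cases}$$ where $k=\left\lceil \frac{M}{L-\nu}\right\rceil$.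
   Context: A typical user can cache up to $M$ packets from a library of $F$ contents, each consisting of $L$ packets; $c_i^o$ is the number of packets of content $i$ cached by the typical user, relaxed to a continuous variable. $(x)^+=\max\{0,x\}$. Content $i$ is requested with probability $f_i=i^{-\gamma}/\sum_{j=1}^F j^{-\gamma}$ (Zipf distribution with exponent $\gamma$). $p_n=\left(\frac{\eta\lambda}{\mu}\right)^n\frac{e^{-\eta\lambda/\mu}}{n!}$ is the probability that $n$ neighboring users capable of transmitting are in the device-to-device communication area (a disc of radius $R$ around the typical user), where $\lambda$ and $\mu$ are the mean rates of the Poisson arrival and departure processes of users and $\eta$ is the probability that a user has enough energy to transmit; $T=1/\mu$ is the expected time of stay. $d_i^\ell$ is the number of packets of content $i$ cached by neighboring user $\ell$; it takes its value with probability $p_{d_i^\ell}$, these distributions being generic but independent and identical among neighboring users, so $p_{\{d_i^1,\dots,d_i^n\}}=\prod_{\ell=1}^n p_{d_i^\ell}$. $\mathcal E$ is the set of all feasible content placements of the $n$ neighboring users, and $u$ is the number of non-zero elements of $(d_i^1,\dots,d_i^n)$, i.e. the number of transmitting users; the terms with $u=0$ are $0$. $\nu$ is written without an index $i$. $\mathbb P[\rho>\tau\mid u=1]=\int_0^R \exp\left(-r^\alpha\left(\frac{P_t}{\sigma^2}\right)^{-1}\tau\right)\frac{2r}{R^2}\,dr$ is the successful transmission probability of a packet with one transmitting user, where $\rho$ is the signal-to-interference-plus-noise ratio, $\tau$ its threshold, $\alpha$ the path-loss exponent, $P_t$ the transmit power and $\sigma^2$ the noise power. The problem is the relaxed minimization,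 in the high mobility regime $T\ll1$ and with orthogonal multiple access, of an approximation (a lower bound from Jensen's inequality) of the average data load of a base station. *)

theory Defs
  imports "HOL-Probability.Probability"
begin

definition zipf :: "nat \<Rightarrow> real \<Rightarrow> nat \<Rightarrow> real" where
  "zipf F \<gamma> i = real i powr (-\<gamma>) / (\<Sum>j=1..F. real j powr (-\<gamma>))"

definition neighbor_prob :: "real \<Rightarrow> real \<Rightarrow> real \<Rightarrow> nat \<Rightarrow> real" where
  "neighbor_prob \<eta> lam \<mu> n = (\<eta> * lam / \<mu>) ^ n * exp (- (\<eta> * lam / \<mu>)) / fact n"

text \<open>The probability that the signal-to-interference-plus-noise ratio exceeds \<open>\<tau>\<close> when
  exactly one user transmits; that user is uniformly distributed on the disc of radius \<open>R\<close>,
  so its distance \<open>r\<close> has density \<open>2 * r / R\<^sup>2\<close>. The noise power is \<open>\<sigma>\<^sup>2\<close>.\<close>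

definition success_prob :: "real \<Rightarrow> real \<Rightarrow> real \<Rightarrow> real \<Rightarrow> real \<Rightarrow> real" where
  "success_prob R \<alpha> Pt \<sigma> \<tau> =
     integral {0..R} (\<lambda>r. exp (- (r powr \<alpha>) * inverse (Pt / \<sigma>\<^sup>2) * \<tau>) * (2 * r / R\<^sup>2))"

text \<open>A placement \<open>d\<close> of one content at \<open>n\<close> neighbors sends neighbor \<open>l\<close> to the number
  \<open>d l\<close> of packets it caches. A tighter cache limit at the neighbors is expressed by the
  support of the placement distribution.\<close>

definition placements :: "nat \<Rightarrow> nat \<Rightarrow> (nat \<Rightarrow> nat) set" where
  "placements L n = {1..n} \<rightarrow>\<^sub>E {0..L}"

definition transmitters :: "nat \<Rightarrow> (nat \<Rightarrow> nat) \<Rightarrow> nat" where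
  "transmitters n d = card {l \<in> {1..n}. d l \<noteq> 0}"

text \<open>The expected number of packets obtained from neighbors (the quantity \<open>\<nu>\<close>), where \<open>q\<close> is the
  common distribution of the number of packets cached by each neighbor. The factor \<open>u\<close> makes the
  terms with \<open>u = 0\<close> vanish. The base \<open>b\<close> of the logarithm is a parameter.\<close>

definition d2d_packets ::
  "real \<Rightarrow> real \<Rightarrow> real \<Rightarrow> real \<Rightarrow> real \<Rightarrow> real \<Rightarrow> real \<Rightarrow> real \<Rightarrow> real \<Rightarrow> nat \<Rightarrow> nat pmf \<Rightarrow> real" where
  "d2d_packets b R \<alpha> Pt \<sigma> \<tau> \<eta> lam \<mu> L q =
     (\<Sum>n. neighbor_prob \<eta> lam \<mu> n *
       (\<Sum>d\<in>placements L n. (\<Prod>l=1..n. pmf q (d l)) *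
         (let u = real (transmitters n d) in
            u * real_of_int \<lfloor>real L / (u * \<mu>) * success_prob R \<alpha> Pt \<sigma> \<tau> * log b (1 + \<tau>)\<rfloor>)))"

text \<open>Here \<open>w i\<close> is the expected number of packets of content \<open>i\<close> obtained from neighbors.\<close>

definition bs_load :: "nat \<Rightarrow> real \<Rightarrow> nat \<Rightarrow> (nat \<Rightarrow> real) \<Rightarrow> (nat \<Rightarrow> real) \<Rightarrow> real" where
  "bs_load F \<gamma> L w c = (\<Sum>i=1..F. zipf F \<gamma> i * max 0 (real L - c i - w i))"

definition feasible :: "nat \<Rightarrow> nat \<Rightarrow> nat \<Rightarrow> (nat \<Rightarrow> real) \<Rightarrow> bool" where
  "feasible F L M c \<longleftrightarrow>
     (\<forall>i\<in>{1..F}. 0 \<le> c i \<and> c i \<le> real L) \<and> (\<Sum>i=1..F. c i) \<le> real M"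

text \<open>If \<open>\<nu> \<ge> L\<close> then \<open>k \<le> 0\<close> (for \<open>\<nu> = L\<close> because \<open>x / 0 = 0\<close>), so nothing is cached.\<close>

definition c_OM :: "nat \<Rightarrow> nat \<Rightarrow> real \<Rightarrow> nat \<Rightarrow> real" where
  "c_OM L M \<nu> i =
     (let k = \<lceil>real M / (real L - \<nu>)\<rceil> in
        if int i < k then real L - \<nu>
        else if int i = k then real M - (real_of_int k - 1) * (real L - \<nu>)
        else 0)"

end

(*
  Since max 0 (D - x) = D - min x D with D = L - \<nu>, the load is a constant minus the reward
  of a fractional knapsack in which each content has capacity D and reward density f i.
  The densities decrease, so filling greedily is optimal; comparing an arbitrary placement
  with the greedy one at the density of the last content that is cached shows optimality, and
  uniqueness when the densities decrease strictly. Feasibility uses 0 \<le> \<nu>, which in turn needs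
  the series for \<nu> to converge: its n-th term is at most the Poisson probability p n times
  L / \<mu> * P[\<rho> > \<tau> | u = 1] * log (1 + \<tau>).
*)
theory Submission
  imports Defs
begin

section \<open>The sign of \<nu> and the convergence of its series\<close>

lemma neighbor_prob_nonneg: "\<lbrakk>0 \<le> \<eta>; 0 \<le> lam; 0 \<le> \<mu>\<rbrakk> \<Longrightarrow> 0 \<le> neighbor_prob \<eta> lam \<mu> n"
  by (simp add: neighbor_prob_def)

lemma summable_neighbor_prob: "summable (neighbor_prob \<eta> lam \<mu>)"
proof -
  have "neighbor_prob \<eta> lam \<mu> =
      (\<lambda>n. exp (- (\<eta> * lam / \<mu>)) * (inverse (fact n) * (\<eta> * lam / \<mu>) ^ n))"
    by (rule ext) (simp add: neighbor_prob_def field_simps)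
  then show ?thesis
    by (simp only: summable_mult summable_exp)
qed

lemma success_prob_nonneg: "0 \<le> success_prob R \<alpha> Pt \<sigma> \<tau>"
proof -
  let ?f = "\<lambda>r. exp (- (r powr \<alpha>) * inverse (Pt / \<sigma>\<^sup>2) * \<tau>) * (2 * r / R\<^sup>2)"
  have "0 \<le> integral {0..R} ?f"
  proof (cases "?f integrable_on {0..R}")
    case True
    then show ?thesis by (rule integral_nonneg) simp
  next
    \<comment> \<open>The parameters are arbitrary, so integrability is left open; without it the
      integral is 0 by convention.\<close>
    case False
    then show ?thesis by (rule eq_refl [OF sym, OF not_integrable_integral])
  qed
  then show ?thesis
    by (simp only: success_prob_def)
qed

text \<open>By independence the sum factors into the \<open>n\<close>-th power of the mass that
  \<open>q\<close> gives to \<open>{0..L}\<close>.\<close>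

lemma sum_placements_le_1: "(\<Sum>d\<in>placements L n. \<Prod>l=1..n. pmf q (d l)) \<le> 1"
proof -
  have "(\<Sum>d\<in>placements L n. \<Prod>l=1..n. pmf q (d l)) = (\<Prod>l=1..n. \<Sum>m\<in>{0..L}. pmf q m)"
    unfolding placements_def by (rule prod_sum_PiE [symmetric]) auto
  also have "\<dots> = measure (measure_pmf q) {0..L} ^ n"
    by (simp add: measure_measure_pmf_finite)
  also have "\<dots> \<le> 1"
    by (simp add: power_le_one)
  finally show ?thesis .
qed

lemma mult_floor_le:
  fixes u a :: real
  assumes "0 \<le> u" and "0 \<le> a"
  shows "u * real_of_int \<lfloor>a / u\<rfloor> \<le> a"
proof (cases "u = 0")
  case False
  have "u * real_of_int \<lfloor>a / u\<rfloor> \<le> u * (a / u)"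
    using assms by (intro mult_left_mono) auto
  then show ?thesis
    using False by simp
qed (use assms in simp)

text \<open>Nonnegative terms alone do not suffice: \<open>suminf\<close> of a divergent series is
  an unspecified value, so the series is first dominated by a multiple of the Poisson
  series.\<close>

lemma d2d_packets_nonneg:
  assumes "b > 1" and "\<tau> > 0" and "0 \<le> \<eta>" and "0 < lam" and "0 < \<mu>"
  shows "0 \<le> d2d_packets b R \<alpha> Pt \<sigma> \<tau> \<eta> lam \<mu> L q"
proof -
  \<comment> \<open>\<open>a\<close> is the argument of the floor for one transmitter and
    \<open>a / u\<close> that for \<open>u\<close> of them, so \<open>mult_floor_le\<close> bounds
    every \<open>g u\<close> by \<open>a\<close>, uniformly in the placement.\<close>
  define a where "a = real L / \<mu> * success_prob R \<alpha> Pt \<sigma> \<tau> * log b (1 + \<tau>)"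
  define g where "g u = u * real_of_int \<lfloor>a / u\<rfloor>" for u :: real
  define s where "s n = (\<Sum>d\<in>placements L n. (\<Prod>l=1..n. pmf q (d l)) * g (real (transmitters n d)))"
    for n
  have a: "0 \<le> a"
    using assms success_prob_nonneg by (simp add: a_def)
  have g: "0 \<le> g u" "g u \<le> a" if "0 \<le> u" for u
    using that a by (auto simp: g_def intro: mult_floor_le)
  have s: "0 \<le> s n" for n
    unfolding s_def by (intro sum_nonneg mult_nonneg_nonneg prod_nonneg g) auto
  have s_le: "s n \<le> a" for n
  proof -
    have "s n \<le> (\<Sum>d\<in>placements L n. (\<Prod>l=1..n. pmf q (d l)) * a)"
      unfolding s_def by (intro sum_mono mult_left_mono g prod_nonneg) auto
    also have "\<dots> = (\<Sum>d\<in>placements L n. \<Prod>l=1..n. pmf q (d l)) * a"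
      by (simp add: sum_distrib_right)
    also have "\<dots> \<le> 1 * a"
      using a by (intro mult_right_mono sum_placements_le_1)
    finally show ?thesis by simp
  qed
  have p: "0 \<le> neighbor_prob \<eta> lam \<mu> n" for n
    using assms by (intro neighbor_prob_nonneg) auto
  have eq: "d2d_packets b R \<alpha> Pt \<sigma> \<tau> \<eta> lam \<mu> L q = (\<Sum>n. neighbor_prob \<eta> lam \<mu> n * s n)"
    unfolding d2d_packets_def s_def g_def a_def Let_def by (simp add: mult_ac)
  have "summable (\<lambda>n. neighbor_prob \<eta> lam \<mu> n * s n)"
  proof (rule summable_comparison_test')
    show "summable (\<lambda>n. neighbor_prob \<eta> lam \<mu> n * a)"
      by (intro summable_mult2 summable_neighbor_prob)
    show "norm (neighbor_prob \<eta> lam \<mu> n * s n) \<le> neighbor_prob \<eta> lam \<mu> n * a" for n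
      using p s s_le by (simp add: abs_mult mult_left_mono)
  qed
  then show ?thesis
    unfolding eq by (intro suminf_nonneg mult_nonneg_nonneg p s)
qed

section \<open>Monotonicity of the Zipf weights\<close>

lemma zipf_pos:
  assumes "1 \<le> i" and "i \<le> F"
  shows "0 < zipf F \<gamma> i"
proof -
  have "0 < (\<Sum>j=1..F. real j powr (-\<gamma>))"
    using assms by (intro sum_pos) auto
  then show ?thesis
    using assms by (simp add: zipf_def)
qed

lemma zipf_antimono:
  assumes "0 \<le> \<gamma>" and "1 \<le> i" and "i \<le> j"
  shows "zipf F \<gamma> j \<le> zipf F \<gamma> i"
  unfolding zipf_def using assms
  by (intro divide_right_mono sum_nonneg) (auto simp: powr_minus intro!: le_imp_inverse_le powr_mono2)

lemma zipf_strict_antimono: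
  assumes "0 < \<gamma>" and "1 \<le> i" and "i < j" and "j \<le> F"
  shows "zipf F \<gamma> j < zipf F \<gamma> i"
proof -
  have "0 < (\<Sum>j=1..F. real j powr (-\<gamma>))"
    using assms by (intro sum_pos) auto
  then show ?thesis
    using assms unfolding zipf_def
    by (intro divide_strict_right_mono) (auto simp: powr_minus intro!: powr_less_mono2)
qed

section \<open>The exchange argument for weighted sums\<close>

lemma sum_exchange:
  fixes w s x :: "'a \<Rightarrow> real"
  shows "(\<Sum>i\<in>A. w i * s i) - (\<Sum>i\<in>A. w i * x i)
    = (\<Sum>i\<in>A. (w i - t) * (s i - x i)) + t * (sum s A - sum x A)"
  by (simp add: sum_distrib_left sum_subtractf [symmetric] sum.distrib [symmetric] algebra_simps)

lemma sum_exchange_le: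
  fixes w s x :: "'a \<Rightarrow> real"
  assumes "0 \<le> t" and "\<And>i. i \<in> A \<Longrightarrow> 0 \<le> (w i - t) * (s i - x i)" and "sum x A \<le> sum s A"
  shows "(\<Sum>i\<in>A. w i * x i) \<le> (\<Sum>i\<in>A. w i * s i)"
proof -
  have "0 \<le> (\<Sum>i\<in>A. (w i - t) * (s i - x i))" "0 \<le> t * (sum s A - sum x A)"
    using assms by (auto intro: sum_nonneg)
  with sum_exchange [of w s A x t] show ?thesis
    by linarith
qed

text \<open>Equal rewards make both nonnegative terms of \<open>sum_exchange\<close> vanish. The
  first forces agreement wherever the weight differs from \<open>w p\<close>; it says nothing at
  \<open>p\<close>, where the equality of the totals decides.\<close>

lemma sum_exchange_eq:
  fixes w s x :: "'a \<Rightarrow> real"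
  assumes "finite A" and "p \<in> A" and "0 < w p"
    and nonneg: "\<And>i. i \<in> A \<Longrightarrow> 0 \<le> (w i - w p) * (s i - x i)"
    and "\<And>i. i \<in> A - {p} \<Longrightarrow> w i \<noteq> w p"
    and "sum x A \<le> sum s A" and "(\<Sum>i\<in>A. w i * s i) \<le> (\<Sum>i\<in>A. w i * x i)" and "i \<in> A"
  shows "x i = s i"
proof -
  have "0 \<le> (\<Sum>i\<in>A. (w i - w p) * (s i - x i))" "0 \<le> w p * (sum s A - sum x A)"
    using assms by (auto intro: sum_nonneg)
  with sum_exchange [of w s A x "w p"] assms(7)
  have 0: "(\<Sum>i\<in>A. (w i - w p) * (s i - x i)) = 0" "w p * (sum s A - sum x A) = 0"
    by linarith+
  have off: "x j = s j" if "j \<in> A - {p}" for j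
    using sum_nonneg_eq_0_iff [OF \<open>finite A\<close> nonneg] 0(1) that assms(5) [of j] by fastforce
  have "sum x (A - {p}) = sum s (A - {p})"
    using off by (rule sum.cong [OF refl])
  then have "x p = s p"
    using 0(2) \<open>0 < w p\<close> sum.remove [OF \<open>finite A\<close> \<open>p \<in> A\<close>, of x]
      sum.remove [OF \<open>finite A\<close> \<open>p \<in> A\<close>, of s] by simp
  with off \<open>i \<in> A\<close> show ?thesis by blast
qed

section \<open>The load as a capped reward, and the greedy placement\<close>

lemma bs_load_eq:
  assumes "\<And>i. i \<in> {1..F} \<Longrightarrow> w i = \<nu>"
  shows "bs_load F \<gamma> L w c = (\<Sum>i=1..F. zipf F \<gamma> i) * (real L - \<nu>)
    - (\<Sum>i=1..F. zipf F \<gamma> i * min (c i) (real L - \<nu>))"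
proof -
  have "bs_load F \<gamma> L w c = (\<Sum>i=1..F. zipf F \<gamma> i * (real L - \<nu> - min (c i) (real L - \<nu>)))"
    unfolding bs_load_def using assms by (intro sum.cong refl arg_cong2 [of _ _ _ _ "(*)"]) auto
  then show ?thesis
    by (simp add: right_diff_distrib sum_subtractf sum_distrib_right)
qed

lemma c_OM_eq_0:
  assumes "real L \<le> \<nu>" and "1 \<le> i"
  shows "c_OM L M \<nu> i = 0"
proof -
  have "real M / (real L - \<nu>) \<le> 0"
    using assms by (simp add: divide_nonneg_nonpos)
  then have "\<lceil>real M / (real L - \<nu>)\<rceil> \<le> 0"
    by (simp add: ceiling_le_iff)
  then have "\<not> int i < \<lceil>real M / (real L - \<nu>)\<rceil>" "int i \<noteq> \<lceil>real M / (real L - \<nu>)\<rceil>"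
    using assms by linarith+
  then show ?thesis
    by (simp add: c_OM_def)
qed

text \<open>The pivot is \<open>max 1 k\<close>: for \<open>M = 0\<close> the index \<open>k\<close> is \<open>0\<close> and lies outside the library.\<close>

lemma c_OM_pivot:
  assumes "\<nu> < real L"
  obtains p :: nat where "1 \<le> p" and "(real p - 1) * (real L - \<nu>) \<le> real M"
    and "real M \<le> real p * (real L - \<nu>)" and "p = 1 \<or> (real p - 1) * (real L - \<nu>) < real M"
    and "\<And>i. 1 \<le> i \<Longrightarrow> c_OM L M \<nu> i = (if i < p then real L - \<nu>
      else if i = p then real M - (real p - 1) * (real L - \<nu>) else 0)"
proof -
  define D where "D = real L - \<nu>"
  define k where "k = \<lceil>real M / D\<rceil>"
  have D: "0 < D" using assms by (simp add: D_def)
  have "0 \<le> real M / D" using D by simp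
  then have k: "0 \<le> k" unfolding k_def by linarith
  have k_le: "real M \<le> real_of_int k * D"
    using D le_of_int_ceiling [of "real M / D"] unfolding k_def by (subst (asm) pos_divide_le_eq) auto
  have k_less: "(real_of_int k - 1) * D < real M"
    using D ceiling_correct [of "real M / D"] by (simp only: k_def pos_less_divide_eq)
  have c: "c_OM L M \<nu> i = (if int i < k then D
      else if int i = k then real M - (real_of_int k - 1) * D else 0)" for i
    by (simp add: c_OM_def Let_def D_def k_def)
  show thesis
  proof (cases "k = 0")
    case True
    \<comment> \<open>With pivot 1 the entry \<open>M - 0 * D\<close> is 0, as \<open>c_OM\<close>
      prescribes beyond \<open>k = 0\<close>. The strict lower bound fails here, hence the
      alternative \<open>p = 1\<close> in the conclusion.\<close>
    then have "real M = 0" using k_le by simp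
    with True D c show thesis
      by (intro that [of 1]) (auto simp: D_def)
  next
    case False
    with k obtain p where p: "k = int p" "1 \<le> p"
      using nonneg_int_cases [of k] by (metis One_nat_def Suc_leI of_nat_0 gr0I)
    with k_le k_less c show thesis
      by (intro that [of p]) (auto simp: D_def)
  qed
qed

text \<open>The pivot entry subtracts exactly what the \<open>p - 1\<close> full entries before it
  add, so the budget is exhausted.\<close>

lemma sum_greedy:
  fixes D m :: real
  assumes "1 \<le> p" and "p \<le> F"
  shows "(\<Sum>i=1..F. if i < p then D else if i = p then m - (real p - 1) * D else 0) = m"
proof -
  let ?g = "\<lambda>i. if i < p then D else if i = p then m - (real p - 1) * D else 0"
  have "sum ?g {1..F} = sum ?g {1..p}"
    using assms by (intro sum.mono_neutral_right) auto
  also have "\<dots> = ?g p + sum ?g {1..<p}"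
    using assms by (subst sum.last_plus) auto
  also have "sum ?g {1..<p} = (\<Sum>i=1..<p. D)"
    by (intro sum.cong) auto
  finally show ?thesis
    using assms by (simp add: of_nat_diff)
qed

text \<open>Uniqueness is claimed only under extra conditions: for \<open>\<gamma> = 0\<close> all
  contents are equally popular, for \<open>\<nu> \<ge> L\<close> every feasible load is 0, and
  storage beyond \<open>F * (L - \<nu>)\<close> can raise entries above \<open>L - \<nu>\<close>
  without changing the load if \<nu> is positive. As \<nu> has no index, the distributions
  \<open>q i\<close> may differ but must give the same value.\<close>

theorem theorem1:
  fixes F L M :: nat and \<gamma> b R \<alpha> Pt \<sigma> \<tau> \<eta> lam \<mu> \<nu> :: real
    and q :: "nat \<Rightarrow> nat pmf" and load :: "(nat \<Rightarrow> real) \<Rightarrow> real"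
  assumes "F \<ge> 1" and "\<gamma> \<ge> 0"
    and "b > 1" and "R > 0" and "\<alpha> > 0" and "Pt > 0" and "\<sigma> > 0" and "\<tau> > 0"
    and "0 \<le> \<eta>" and "\<eta> \<le> 1" and "lam > 0" and "\<mu> > 0"
    and "\<And>i. i \<in> {1..F} \<Longrightarrow> set_pmf (q i) \<subseteq> {0..L}"
    and "\<And>i. i \<in> {1..F} \<Longrightarrow> d2d_packets b R \<alpha> Pt \<sigma> \<tau> \<eta> lam \<mu> L (q i) = \<nu>"
  defines "load \<equiv> bs_load F \<gamma> L (\<lambda>i. d2d_packets b R \<alpha> Pt \<sigma> \<tau> \<eta> lam \<mu> L (q i))"
  shows "is_arg_min load (feasible F L M) (c_OM L M \<nu>) \<and>
    (\<gamma> > 0 \<and> \<nu> < real L \<and> real M \<le> real F * (real L - \<nu>) \<longrightarrow>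
      (\<forall>c. is_arg_min load (feasible F L M) c \<longrightarrow> (\<forall>i\<in>{1..F}. c i = c_OM L M \<nu> i)))"
proof -
  define D where "D = real L - \<nu>"
  let ?f = "zipf F \<gamma>" and ?s = "c_OM L M \<nu>" and ?P = "feasible F L M"
  have "0 \<le> \<nu>"
    using d2d_packets_nonneg [of b \<tau> \<eta> lam \<mu> R \<alpha> Pt \<sigma> L "q 1"] assms(1-12) assms(14) [of 1] by simp
  then have D_le: "D \<le> real L" by (simp add: D_def)
  have load: "load c = sum ?f {1..F} * D - (\<Sum>i=1..F. ?f i * min (c i) D)" for c
    unfolding load_def D_def by (rule bs_load_eq) (rule assms(14))
  \<comment> \<open>Settles optimality in the two extreme cases, \<open>D \<le> 0\<close> and
    \<open>p > F\<close>, where the claimed placement has load 0.\<close>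
  have load_nonneg: "0 \<le> load c" for c
    unfolding load_def bs_load_def
    by (intro sum_nonneg mult_nonneg_nonneg less_imp_le [OF zipf_pos]) auto
  show ?thesis
  proof (cases "D \<le> 0")
    case True
    then have s0: "?s i = 0" if "1 \<le> i" for i
      using c_OM_eq_0 that by (simp add: D_def)
    have "load ?s = 0"
      using True s0 by (simp add: load sum_distrib_right min_def)
    moreover have "?P ?s"
      using s0 by (simp add: feasible_def)
    ultimately show ?thesis
      using True load_nonneg by (auto simp: is_arg_min_def not_less D_def)
  next
    case False
    then have D: "0 < D" by simp
    then have \<nu>: "\<nu> < real L" by (simp add: D_def)
    obtain p where p1: "1 \<le> p" and p_low: "(real p - 1) * D \<le> real M"
      and p_up: "real M \<le> real p * D" and p_strict: "p = 1 \<or> (real p - 1) * D < real M"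
      and s: "\<And>i. 1 \<le> i \<Longrightarrow>
        ?s i = (if i < p then D else if i = p then real M - (real p - 1) * D else 0)"
      by (rule c_OM_pivot [OF \<nu>, of M, folded D_def]) (rule that)
    have s_nonneg: "0 \<le> ?s i" and s_le: "?s i \<le> D" if "1 \<le> i" for i
      using s [OF that] D p_low p_up by (auto simp: left_diff_distrib)
    have load_s: "load ?s = sum ?f {1..F} * D - (\<Sum>i=1..F. ?f i * ?s i)"
      unfolding load using s_le by (auto simp: min_absorb1 intro!: sum.cong)
    show ?thesis
    proof (cases "p \<le> F")
      case True
      have sum_s: "sum ?s {1..F} = real M"
        using sum_greedy [OF p1 True, of D "real M"] s by simp
      have feas: "?P ?s"
        unfolding feasible_def using sum_s s_nonneg s_le D_le by fastforce
      \<comment> \<open>The price is the popularity of the pivot. Before \<open>p\<close> weights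
        are at least \<open>?f p\<close> and \<open>?s i = D\<close> is the cap; after
        \<open>p\<close> they are at most \<open>?f p\<close> and \<open>?s i = 0\<close>; at
        \<open>p\<close> the first factor is 0.\<close>
      have signs: "0 \<le> (?f i - ?f p) * (?s i - min (c i) D)" if "?P c" "i \<in> {1..F}" for c i
      proof -
        have "0 \<le> min (c i) D"
          using that D by (auto simp: feasible_def)
        then show ?thesis
          using that s [of i] zipf_antimono [OF assms(2), of i p F]
            zipf_antimono [OF assms(2), of p i F] p1
          by (cases i p rule: linorder_cases)
            (auto intro: mult_nonpos_nonneg mult_nonneg_nonneg)
      qed
      \<comment> \<open>Truncating a competitor at \<open>D\<close> keeps its reward and can only
        save storage.\<close>
      have sum_min: "(\<Sum>i=1..F. min (c i) D) \<le> (\<Sum>i=1..F. c i)" for c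
        by (intro sum_mono) auto
      have sum_le: "(\<Sum>i=1..F. min (c i) D) \<le> sum ?s {1..F}" if "?P c" for c
        using sum_min [of c] that sum_s by (simp add: feasible_def)
      have "load ?s \<le> load c" if "?P c" for c
        unfolding load_s load [of c]
        using sum_exchange_le [OF less_imp_le [OF zipf_pos [OF p1 True]] signs [OF that] sum_le [OF that]]
        by simp
      then have "is_arg_min load ?P ?s"
        using feas by (auto simp: is_arg_min_def not_less)
      moreover have "c i = ?s i"
        if "\<gamma> > 0" and c: "is_arg_min load ?P c" and i: "i \<in> {1..F}" for c i
      proof -
        have Pc: "?P c" and "load c \<le> load ?s"
          using c feas by (auto simp: is_arg_min_def not_less)
        then have le: "(\<Sum>i=1..F. ?f i * ?s i) \<le> (\<Sum>i=1..F. ?f i * min (c i) D)"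
          unfolding load_s load [of c] by simp
        have "?f j \<noteq> ?f p" if "j \<in> {1..F} - {p}" for j
          using that zipf_strict_antimono [OF \<open>\<gamma> > 0\<close>, of j p F]
            zipf_strict_antimono [OF \<open>\<gamma> > 0\<close>, of p j F] p1 True
          by (cases j p rule: linorder_cases) auto
        then have eq: "min (c j) D = ?s j" if "j \<in> {1..F}" for j
          using sum_exchange_eq [of "{1..F}" p ?f ?s "\<lambda>i. min (c i) D", OF _ _ _ signs [OF Pc] _ sum_le [OF Pc] le]
            zipf_pos [OF p1 True] p1 True that by simp
        \<comment> \<open>So far only the truncation of \<open>c\<close> is determined. It already
          uses the whole budget \<open>M\<close>, which leaves nothing for an excess over
          \<open>D\<close>.\<close>
        have "(\<Sum>i=1..F. c i - min (c i) D) = (\<Sum>i=1..F. c i) - (\<Sum>i=1..F. ?s i)"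
          using eq by (simp add: sum_subtractf)
        also have "\<dots> \<le> 0"
          using Pc sum_s by (simp add: feasible_def)
        finally have "(\<Sum>i=1..F. c i - min (c i) D) = 0"
          by (intro antisym sum_nonneg) auto
        then have "c i - min (c i) D = 0"
          using i by (subst (asm) sum_nonneg_eq_0_iff) auto
        with eq [OF i] show ?thesis by simp
      qed
      ultimately show ?thesis by blast
    next
      case False
      then have sD: "?s i = D" if "i \<in> {1..F}" for i
        using s that by auto
      have "real F * D \<le> (real p - 1) * D"
        using False D by (intro mult_right_mono) auto
      also note p_low
      finally have FD: "real F * D \<le> real M" .
      then have "?P ?s"
        unfolding feasible_def using sD D D_le by simp
      moreover have "load ?s = 0"
        unfolding load_s using sD by (simp add: sum_distrib_right)
      \<comment> \<open>Makes the uniqueness claim vacuous. The alternative \<open>p = 1\<close> is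
        impossible since \<open>p > F \<ge> 1\<close>.\<close>
      moreover have "real F * D < real M"
        using False p_strict assms(1) \<open>real F * D \<le> (real p - 1) * D\<close> by auto
      ultimately show ?thesis
        using load_nonneg by (auto simp: is_arg_min_def not_less D_def)
    qed
  qed
qed

end
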